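(* Let $(\mathcal{A},\varphi)$ be a non-commutative probability space and let $(a,b)$ be a two-faced pair in $(\mathcal{A},\varphi)$ (that is, $a,b\in\mathcal{A}$, with $a$ regarded as a left and $b$ as a right operator) with $\varphi(b)=1$. Then, as formal power series, $$T_{a,b}(z,w) = 1+\frac{1}{w}\,K_{a,b}\!\left(z,\,c_b^{\langle -1\rangle}(w)\right),$$ where $T_{a,b}$ is the $2$-variable partial bi-free $T$-transform of $(a,b)$.
   Context: A non-commutative probability space $(\mathcal{A},\varphi)$ is a unital complex algebra $\mathcal{A}$ with a linear functional $\varphi:\mathcal{A}\to\mathbb{C}$ such that $\varphi(I)=1$. All series are treated as formal series in commuting variables; $\langle -1\rangle$ denotes the inverse under composition. One-variable series. $\kappa_n(a)$ is the $n$-th free cumulant of $a$ and $c_a(z)=\sum_{n\ge1}\kappa_n(a)z^n$. $G_a(z)=\varphi((zI-a)^{-1})=\frac1z\sum_{n\ge0}\varphi(a^n)z^{-n}$ is the Cauchy transform, and $K_a(z)$ is its inverse under composition, $G_a(K_a(z))=z$ (so $K_a(z)=\frac1z+\cdots$, and $1/K_a(z)$ is a power series with zero constant term). For $\varphi(b)\ne0$, $\psi_b(w)=\sum_{n\ge1}\varphi(b^n)w^n$ and $\mathcal{X}_b(w)=\psi_b^{\langle-1\rangle}(w)$. Bi-non-crossing partitions and $(\ell,r)$-cumulants. For $\chi:\{1,\dots,n\}\to\{\ell,r\}$, order $\{1,\dots,n\}$ by listing first the elements of $\chi^{-1}(\ell)$ in increasing order and then the elements of $\chi^{-1}(r)$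 in decreasing order. $BNC(\chi)$ is the set of partitions of $\{1,\dots,n\}$ that are non-crossing with respect to this order. The $(\ell,r)$-cumulants $\kappa_\chi:\mathcal{A}^n\to\mathbb{C}$ are the multilinear functionals determined recursively by $$\varphi(a_1\cdots a_n)=\sum_{\pi\in BNC(\chi)}\ \prod_{B\text{ block of }\pi}\kappa_{\chi|_B}\big((a_1,\dots,a_n)|_B\big),$$ where $(a_1,\dots,a_n)|_B$ keeps only the entries with index in $B$. For $n,m\ge1$, $\kappa_{n,m}(a,b)=\kappa_{\chi}(a,\dots,a,b,\dots,b)$ with $n$ copies of $a$ followed by $m$ copies of $b$, where $\chi(k)=\ell$ for $k\le n$ and $\chi(k)=r$ for $n<k\le n+m$. Define $$K_{a,b}(z,w)=\sum_{n,m\ge1}\kappa_{n,m}(a,b)z^nw^m .$$ The $T$-transform. Let $F_{a,b}(z,w)=\varphi((zI-a)^{-1}(1-wb)^{-1})=\frac1z\sum_{n,m\ge0}\varphi(a^nb^m)z^{-n}w^m$. For $\varphi(b)\neq0$, $$T_{a,b}(z,w)=\frac{w+1}{w}\left(1-\frac{z}{F_{a,b}(K_a(z),\mathcal{X}_b(w))}\right).$$ *)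

theory Defs
  imports "HOL-Computational_Algebra.Computational_Algebra" "HOL-Library.Disjoint_Sets"
begin

section \<open>Non-commutative probability spaces\<close>

locale noncomm_prob_space = vector_space scale
  for scale :: "complex \<Rightarrow> 'a::ring_1 \<Rightarrow> 'a" +
  fixes \<phi> :: "'a \<Rightarrow> complex"
  assumes scale_mult_left: "scale c x * y = scale c (x * y)"
    and scale_mult_right: "x * scale c y = scale c (x * y)"
    and phi_linear: "Vector_Spaces.linear scale (*) \<phi>"
    and phi_one: "\<phi> 1 = 1"


section \<open>Partitions and cumulants\<close>

text \<open>Index sets are \<open>{..<n}\<close>, i.e. all indices are shifted by one against \<open>{1,\<dots>,n}\<close>.\<close>

definition noncrossing :: "(nat \<Rightarrow> nat \<Rightarrow> bool) \<Rightarrow> nat set set \<Rightarrow> bool" where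
  "noncrossing lt \<pi> \<longleftrightarrow>
     (\<forall>V\<in>\<pi>. \<forall>W\<in>\<pi>. \<forall>i\<in>V. \<forall>j\<in>W. \<forall>k\<in>V. \<forall>l\<in>W.
        lt i j \<and> lt j k \<and> lt k l \<longrightarrow> V = W)"

definition NC :: "nat \<Rightarrow> nat set set set" where
  "NC n = {\<pi>. partition_on {..<n} \<pi> \<and> noncrossing (<) \<pi>}"

datatype face = Lft | Rgt

text \<open>Left indices come first, in increasing order, followed by the right indices in
  decreasing order.\<close>

definition chi_less :: "face list \<Rightarrow> nat \<Rightarrow> nat \<Rightarrow> bool" where
  "chi_less \<chi> i j \<longleftrightarrow>
     (case (\<chi> ! i, \<chi> ! j) of
        (Lft, Lft) \<Rightarrow> i < j
      | (Lft, Rgt) \<Rightarrow> True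
      | (Rgt, Lft) \<Rightarrow> False
      | (Rgt, Rgt) \<Rightarrow> j < i)"

definition BNC :: "face list \<Rightarrow> nat set set set" where
  "BNC \<chi> = {\<pi>. partition_on {..<length \<chi>} \<pi> \<and> noncrossing (chi_less \<chi>) \<pi>}"

lemma finite_NC: "finite (NC n)"
  by (rule finite_subset[OF _ finitely_many_partition_on[of "{..<n}"]]) (auto simp: NC_def)

lemma finite_BNC: "finite (BNC \<chi>)"
  by (rule finite_subset[OF _ finitely_many_partition_on[of "{..<length \<chi>}"]])
    (auto simp: BNC_def)

lemma full_in_NC: "0 < n \<Longrightarrow> {{..<n}} \<in> NC n"
  by (auto simp: NC_def partition_on_def noncrossing_def)

lemma full_in_BNC: "\<chi> \<noteq> [] \<Longrightarrow> {{..<length \<chi>}} \<in> BNC \<chi>"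
  by (auto simp: BNC_def partition_on_def noncrossing_def)

lemma partition_on_proper_block:
  assumes "partition_on A \<pi>" "\<pi> \<noteq> {A}" "B \<in> \<pi>"
  shows "B \<subset> A"
proof (rule ccontr)
  assume "\<not> B \<subset> A"
  with assms have "B = A" by (auto simp: partition_on_def)
  have "C = A" if "C \<in> \<pi>" for C
  proof (rule ccontr)
    assume "C \<noteq> A"
    hence "C \<inter> A = {}"
      using assms(1,3) that \<open>B = A\<close> by (auto simp: partition_on_def disjoint_def)
    moreover have "C \<noteq> {}" "C \<subseteq> A" using assms(1) that by (auto simp: partition_on_def)
    ultimately show False by auto
  qed
  with assms(3) have "\<pi> = {A}" by blast
  with assms(2) show False by simp
qed

lemma length_nths_proper:
  assumes "partition_on {..<length xs} \<pi>" "\<pi> \<noteq> {{..<length xs}}" "B \<in> \<pi>"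
  shows "length (nths xs B) < length xs"
proof -
  have "B \<subset> {..<length xs}" using partition_on_proper_block assms by blast
  hence "card B < length xs"
    by (metis card_lessThan finite_lessThan psubset_card_mono)
  moreover have "{i. i < length xs \<and> i \<in> B} = B"
    using \<open>B \<subset> {..<length xs}\<close> by auto
  ultimately show ?thesis by (simp add: length_nths)
qed

text \<open>The moment-cumulant formulas, solved for the term of the one-block partition; see
  \<open>moment_free_cumulant\<close> and \<open>moment_lr_cumulant\<close> below.\<close>

function free_cumulant :: "('a::ring_1 \<Rightarrow> complex) \<Rightarrow> 'a \<Rightarrow> nat \<Rightarrow> complex" where
  "free_cumulant \<phi> a n =
     \<phi> (a ^ n) - (\<Sum>\<pi>\<in>NC n - {{{..<n}}}. \<Prod>B\<in>\<pi>. free_cumulant \<phi> a (card B))"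
  by auto
termination
proof (relation "measure (\<lambda>(\<phi>, a, n). n)")
  fix \<phi> :: "'a \<Rightarrow> complex" and a :: 'a and n \<pi> B
  assume "\<pi> \<in> NC n - {{{..<n}}}" "B \<in> \<pi>"
  hence "B \<subset> {..<n}" by (intro partition_on_proper_block) (auto simp: NC_def)
  hence "card B < n" by (metis card_lessThan finite_lessThan psubset_card_mono)
  thus "((\<phi>, a, card B), \<phi>, a, n) \<in> measure (\<lambda>(\<phi>, a, n). n)" by simp
qed simp

text \<open>\<open>lr_cumulant \<phi> \<chi> as\<close> is meant for \<open>length as = length \<chi>\<close>.\<close>

function lr_cumulant :: "('a::ring_1 \<Rightarrow> complex) \<Rightarrow> face list \<Rightarrow> 'a list \<Rightarrow> complex" where
  "lr_cumulant \<phi> \<chi> as =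
     \<phi> (prod_list as) -
     (\<Sum>\<pi>\<in>BNC \<chi> - {{{..<length \<chi>}}}. \<Prod>B\<in>\<pi>. lr_cumulant \<phi> (nths \<chi> B) (nths as B))"
  by auto
termination
  by (relation "measure (\<lambda>(\<phi>, \<chi>, as). length \<chi>)")
    (auto simp: BNC_def intro: length_nths_proper)

declare free_cumulant.simps [simp del] lr_cumulant.simps [simp del]

lemma moment_free_cumulant:
  assumes "0 < n"
  shows "\<phi> (a ^ n) = (\<Sum>\<pi>\<in>NC n. \<Prod>B\<in>\<pi>. free_cumulant \<phi> a (card B))"
  by (subst sum.remove[OF finite_NC full_in_NC[OF assms]])
    (simp add: free_cumulant.simps[of \<phi> a n])

lemma moment_lr_cumulant:
  assumes "\<chi> \<noteq> []" "length as = length \<chi>"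
  shows "\<phi> (prod_list as) =
    (\<Sum>\<pi>\<in>BNC \<chi>. \<Prod>B\<in>\<pi>. lr_cumulant \<phi> (nths \<chi> B) (nths as B))"
proof -
  have "nths \<chi> {..<length \<chi>} = \<chi>" "nths as {..<length \<chi>} = as"
    using assms(2) by (simp_all add: nths_all)
  thus ?thesis
    by (subst sum.remove[OF finite_BNC full_in_BNC[OF assms(1)]])
      (simp add: lr_cumulant.simps[of \<phi> \<chi> as])
qed

definition kappa2 :: "('a::ring_1 \<Rightarrow> complex) \<Rightarrow> 'a \<Rightarrow> 'a \<Rightarrow> nat \<Rightarrow> nat \<Rightarrow> complex" where
  "kappa2 \<phi> a b n m =
     lr_cumulant \<phi> (replicate n Lft @ replicate m Rgt) (replicate n a @ replicate m b)"


section \<open>Formal series in two variables\<close>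

text \<open>A power series in \<open>z\<close> and \<open>w\<close> has type \<open>complex fps fps\<close>: the outer variable is \<open>w\<close>,
  and the coefficient of \<open>w ^ m\<close> is a power series in \<open>z\<close>. Quotients are taken in the field
  \<open>complex fls fls\<close> of formal Laurent series in \<open>w\<close> over the formal Laurent series in \<open>z\<close>.\<close>

definition fps2 :: "(nat \<Rightarrow> nat \<Rightarrow> complex) \<Rightarrow> complex fps fps" where
  "fps2 f = Abs_fps (\<lambda>m. Abs_fps (\<lambda>n. f n m))"

definition fps2_to_fls2 :: "complex fps fps \<Rightarrow> complex fls fls" where
  "fps2_to_fls2 f = fps_to_fls (Abs_fps (\<lambda>m. fps_to_fls (f $ m)))"

abbreviation var_z :: "complex fls fls" where
  "var_z \<equiv> fls_const fls_X"

abbreviation var_w :: "complex fls fls" where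
  "var_w \<equiv> fls_X"

text \<open>\<open>f (g(z), h(w))\<close>, for \<open>g\<close> and \<open>h\<close> without constant term.\<close>

definition fps2_compose :: "complex fps fps \<Rightarrow> complex fps \<Rightarrow> complex fps \<Rightarrow> complex fps fps" where
  "fps2_compose f g h =
     fps_compose (Abs_fps (\<lambda>m. fps_compose (f $ m) g)) (Abs_fps (\<lambda>m. fps_const (h $ m)))"


section \<open>Transforms\<close>

definition c_series :: "('a::ring_1 \<Rightarrow> complex) \<Rightarrow> 'a \<Rightarrow> complex fps" where
  "c_series \<phi> a = Abs_fps (\<lambda>n. if n = 0 then 0 else free_cumulant \<phi> a n)"

text \<open>The Cauchy transform \<open>G\<^sub>a(z) = (\<Sum>n. \<phi> (a ^ n) z\<^bsup>-n-1\<^esup>)\<close> is recorded as a power series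
  in \<open>1/z\<close>, so that \<open>G\<^sub>a(K\<^sub>a(z)) = z\<close> says that \<open>1 / K\<^sub>a(z)\<close> is its compositional inverse.\<close>

definition cauchy_series :: "('a::ring_1 \<Rightarrow> complex) \<Rightarrow> 'a \<Rightarrow> complex fps" where
  "cauchy_series \<phi> a = Abs_fps (\<lambda>k. if k = 0 then 0 else \<phi> (a ^ (k - 1)))"

definition K_series :: "('a::ring_1 \<Rightarrow> complex) \<Rightarrow> 'a \<Rightarrow> complex fls" where
  "K_series \<phi> a = inverse (fps_to_fls (fps_inv (cauchy_series \<phi> a)))"

lemma inverse_K_series:
  "fps_to_fls (fls_regpart (inverse (K_series \<phi> a))) = inverse (K_series \<phi> a)"
  by (simp add: K_series_def)

lemma cauchy_series_K_series:
  assumes "\<phi> 1 = 1"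
  shows "fps_compose (cauchy_series \<phi> a) (fls_regpart (inverse (K_series \<phi> a))) = fps_X"
  using assms by (simp add: K_series_def fps_inv_right cauchy_series_def)

definition psi_series :: "('a::ring_1 \<Rightarrow> complex) \<Rightarrow> 'a \<Rightarrow> complex fps" where
  "psi_series \<phi> b = Abs_fps (\<lambda>n. if n = 0 then 0 else \<phi> (b ^ n))"

definition X_series :: "('a::ring_1 \<Rightarrow> complex) \<Rightarrow> 'a \<Rightarrow> complex fps" where
  "X_series \<phi> b = fps_inv (psi_series \<phi> b)"

definition K2_series :: "('a::ring_1 \<Rightarrow> complex) \<Rightarrow> 'a \<Rightarrow> 'a \<Rightarrow> complex fps fps" where
  "K2_series \<phi> a b = fps2 (\<lambda>n m. if n = 0 \<or> m = 0 then 0 else kappa2 \<phi> a b n m)"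

text \<open>Like the Cauchy transform, \<open>F\<^sub>a\<^sub>,\<^sub>b(z, w)\<close> is recorded as a power series in \<open>1/z\<close> and \<open>w\<close>:
  the coefficient of \<open>z\<^bsup>-k\<^esup> w\<^bsup>m\<^esup>\<close> is \<open>\<phi> (a\<^bsup>k-1\<^esup> b\<^bsup>m\<^esup>)\<close> for \<open>k \<ge> 1\<close>.\<close>

definition F_series :: "('a::ring_1 \<Rightarrow> complex) \<Rightarrow> 'a \<Rightarrow> 'a \<Rightarrow> complex fps fps" where
  "F_series \<phi> a b = fps2 (\<lambda>k m. if k = 0 then 0 else \<phi> (a ^ (k - 1) * b ^ m))"

definition F_subst ::
  "('a::ring_1 \<Rightarrow> complex) \<Rightarrow> 'a \<Rightarrow> 'a \<Rightarrow> complex fls \<Rightarrow> complex fps \<Rightarrow> complex fls fls" where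
  "F_subst \<phi> a b K X =
     fps2_to_fls2 (fps2_compose (F_series \<phi> a b) (fls_regpart (inverse K)) X)"

definition T_transform :: "('a::ring_1 \<Rightarrow> complex) \<Rightarrow> 'a \<Rightarrow> 'a \<Rightarrow> complex fls fls" where
  "T_transform \<phi> a b =
     (var_w + 1) / var_w * (1 - var_z / F_subst \<phi> a b (K_series \<phi> a) (X_series \<phi> b))"

end

theory Submission
  imports Defs
begin

text \<open>Let \<open>M\<^sub>a(z) = \<Sum>\<phi>(a\<^sup>n)z\<^sup>n\<close>, \<open>M\<^sub>b(w) = \<Sum>\<phi>(b\<^sup>m)w\<^sup>m\<close> and \<open>H(z,w) = \<Sum>\<phi>(a\<^sup>nb\<^sup>m)z\<^sup>nw\<^sup>m\<close>. In the
  order that defines bi-non-crossing partitions, the word of \<open>n\<close> letters \<open>a\<close> and \<open>m\<close> letters \<open>b\<close> is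
  a row of \<open>n\<close> left points followed by a row of \<open>m\<close> right points, so \<open>\<phi>(a\<^sup>nb\<^sup>m)\<close> is a sum over
  ordinary non-crossing partitions of \<open>n + m\<close> points, in which a block with \<open>p\<close> left and \<open>q\<close> right
  points has weight \<open>\<kappa>\<^sub>p\<^sub>,\<^sub>q\<close>. Sort these partitions by the block of the first point: between two
  consecutive left points of this block there is an arbitrary non-crossing partition of left points,
  which contributes \<open>M\<^sub>a\<close>; the gap that contains the passage from left to right contributes \<open>H\<close>;
  each gap behind a right point contributes \<open>M\<^sub>b\<close>. Together with \<open>c\<^sub>a(z M\<^sub>a(z)) = M\<^sub>a(z) - 1\<close>, the
  same argument for left points alone, this gives
  \<open>H(z,w) = M\<^sub>a(z) M\<^sub>b(w) + K\<^sub>a\<^sub>,\<^sub>b(z M\<^sub>a(z), w M\<^sub>b(w)) H(z,w)\<close>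
  (\<open>joint_moments_functional_equation\<close>).

  Now substitute \<open>y(z) = 1/K\<^sub>a(z)\<close> for \<open>z\<close> and \<open>x(w) = \<X>\<^sub>b(w)\<close> for \<open>w\<close>. By the choice of \<open>y\<close>,
  \<open>y M\<^sub>a(y) = z\<close>. By the choice of \<open>x\<close>, \<open>M\<^sub>b(x) = 1 + w\<close>, and since
  \<open>c\<^sub>b(x M\<^sub>b(x)) = M\<^sub>b(x) - 1 = w\<close>, the argument \<open>x M\<^sub>b(x)\<close> is the compositional inverse of \<open>c\<^sub>b\<close>.
  As \<open>F(K\<^sub>a(z), \<X>\<^sub>b(w)) = y H(y,x)\<close>, the functional equation becomes \<open>F (1 - K) = z (1 + w)\<close>
  with \<open>K = K\<^sub>a\<^sub>,\<^sub>b(z, c\<^sub>b\<^bsup>-1\<^esup>(w))\<close> (\<open>F_subst_functional_equation\<close>). Solving for \<open>z/F\<close> in the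
  field of Laurent series turns the definition of the \<open>T\<close>-transform into the claim.

  The block of the first point is built up one point at a time. The sums therefore run, more
  generally, over partitions in which a given initial set \<open>U\<close> of points lies in one block; the
  block is either \<open>U\<close> itself or \<open>U\<close> followed by a next point \<open>v\<close>, in which case the points before
  \<open>v\<close> split off (\<open>ncsum_step\<close>). On generating functions this is a recursion in the number of
  points of \<open>U\<close>, whose solution is unique because each step carries a factor \<open>z\<close> or \<open>w\<close>.\<close>

section \<open>Sums over non-crossing partitions\<close>

definition nc_partitions ::
  "(nat \<Rightarrow> nat \<Rightarrow> bool) \<Rightarrow> (nat set \<Rightarrow> bool) \<Rightarrow> nat set \<Rightarrow> nat set set set" where
  "nc_partitions lt q C = {\<pi>. partition_on C \<pi> \<and> noncrossing lt \<pi> \<and> (\<forall>B\<in>\<pi>. q B)}"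

definition unsplit :: "nat set \<Rightarrow> nat set \<Rightarrow> bool" where
  "unsplit U B \<longleftrightarrow> B \<inter> U = {} \<or> U \<subseteq> B"

text \<open>The set \<open>U\<close> is meant to be an initial part of the block of the first point; \<open>U = {}\<close> gives
  the sum over all non-crossing partitions of \<open>A\<close>.\<close>

definition ncsum ::
  "(nat \<Rightarrow> nat \<Rightarrow> bool) \<Rightarrow> (nat set \<Rightarrow> complex) \<Rightarrow> nat set \<Rightarrow> nat set \<Rightarrow> complex" where
  "ncsum lt f U A = (\<Sum>\<pi>\<in>nc_partitions lt (unsplit U) (U \<union> A). \<Prod>B\<in>\<pi>. f B)"

lemma finite_nc_partitions: "finite C \<Longrightarrow> finite (nc_partitions lt q C)"
  by (rule finite_subset[OF _ finitely_many_partition_on[of C]]) (auto simp: nc_partitions_def)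

lemma nc_partitions_cong:
  assumes "\<And>B. B \<subseteq> C \<Longrightarrow> B \<noteq> {} \<Longrightarrow> q B \<longleftrightarrow> q' B"
  shows "nc_partitions lt q C = nc_partitions lt q' C"
proof -
  have "(\<forall>B\<in>\<pi>. q B) \<longleftrightarrow> (\<forall>B\<in>\<pi>. q' B)" if "partition_on C \<pi>" for \<pi>
    using that by (intro ball_cong refl assms) (auto simp: partition_on_def)
  thus ?thesis by (auto simp: nc_partitions_def)
qed

lemma nc_partitions_image:
  assumes "\<pi> \<in> nc_partitions lt (unsplit U) C" "inj_on g C" "U \<subseteq> C"
    and lt: "\<And>x y. x \<in> C \<Longrightarrow> y \<in> C \<Longrightarrow> lt' (g x) (g y) \<longleftrightarrow> lt x y"
  shows "image (image g) \<pi> \<in> nc_partitions lt' (unsplit (g ` U)) (g ` C)"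
proof -
  have p: "partition_on C \<pi>" and nc: "noncrossing lt \<pi>" and u: "\<And>B. B \<in> \<pi> \<Longrightarrow> unsplit U B"
    using assms(1) by (auto simp: nc_partitions_def)
  have C: "C = \<Union>\<pi>" using p by (auto simp: partition_on_def)
  have "image (image g) \<pi> - {{}} = image (image g) \<pi>"
    using p by (auto simp: partition_on_def)
  hence "partition_on (g ` C) (image (image g) \<pi>)"
    using partition_on_inj_image[OF p assms(2)] by simp
  moreover have "noncrossing lt' (image (image g) \<pi>)"
    unfolding noncrossing_def
  proof (intro ballI impI, elim imageE, clarify)
    fix V W i j k l
    assume VW: "V \<in> \<pi>" "W \<in> \<pi>" "i \<in> V" "j \<in> W" "k \<in> V" "l \<in> W"
      and "lt' (g i) (g j)" "lt' (g j) (g k)" "lt' (g k) (g l)"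
    hence "lt i j \<and> lt j k \<and> lt k l"
      using lt C by (metis UnionI)
    hence "V = W" using nc VW unfolding noncrossing_def by blast
    thus "g ` V = g ` W" by simp
  qed
  moreover have "unsplit (g ` U) (g ` B)" if "B \<in> \<pi>" for B
  proof -
    have "g ` B \<inter> g ` U = g ` (B \<inter> U)"
      using inj_on_image_Int[OF assms(2), of B U] that C assms(3) by auto
    thus ?thesis using u[OF that] by (auto simp: unsplit_def)
  qed
  ultimately show ?thesis by (auto simp: nc_partitions_def)
qed

text \<open>A non-crossing sum depends only on the order type of its points. This is used both to change
  from the order of bi-non-crossing partitions to the usual one and to identify gaps with initial
  segments of the natural numbers.\<close>

lemma ncsum_reindex:
  assumes inj: "inj_on g (U \<union> A)"
    and lt: "\<And>x y. x \<in> U \<union> A \<Longrightarrow> y \<in> U \<union> A \<Longrightarrow> lt' (g x) (g y) \<longleftrightarrow> lt x y"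
    and f: "\<And>B. B \<subseteq> U \<union> A \<Longrightarrow> f' (g ` B) = f B"
  shows "ncsum lt' f' (g ` U) (g ` A) = ncsum lt f U A"
proof -
  let ?C = "U \<union> A" and ?h = "inv_into (U \<union> A) g"
  have hg: "?h ` g ` B = B" if "B \<subseteq> ?C" for B
    using that inj by (simp add: inv_into_image_cancel)
  have gh: "g ` ?h ` B = B" if "B \<subseteq> g ` ?C" for B
    using that by (simp add: image_inv_into_cancel)
  have sub: "B \<subseteq> C" if "\<pi> \<in> nc_partitions l q C" "B \<in> \<pi>" for B C \<pi> l q
    using that by (auto simp: nc_partitions_def partition_on_def)
  have "(\<Sum>\<pi>\<in>nc_partitions lt (unsplit U) ?C. \<Prod>B\<in>\<pi>. f B) =
        (\<Sum>\<pi>\<in>nc_partitions lt' (unsplit (g ` U)) (g ` ?C). \<Prod>B\<in>\<pi>. f' B)"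
  proof (rule sum.reindex_bij_witness[where i = "image (image ?h)" and j = "image (image g)"])
    fix \<pi> assume P: "\<pi> \<in> nc_partitions lt (unsplit U) ?C"
    show "image (image g) \<pi> \<in> nc_partitions lt' (unsplit (g ` U)) (g ` ?C)"
      by (rule nc_partitions_image[OF P inj]) (use lt in auto)
    have "(\<lambda>B. ?h ` g ` B) ` \<pi> = id ` \<pi>"
      using sub[OF P] by (intro image_cong refl) (simp add: hg)
    thus "image (image ?h) (image (image g) \<pi>) = \<pi>" by (simp add: image_image)
    have "inj_on (image g) \<pi>"
      using inj sub[OF P] by (intro inj_on_image) (auto intro: inj_on_subset)
    thus "(\<Prod>B\<in>image (image g) \<pi>. f' B) = (\<Prod>B\<in>\<pi>. f B)"
      using sub[OF P] f by (simp add: prod.reindex)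
  next
    fix \<pi> assume P: "\<pi> \<in> nc_partitions lt' (unsplit (g ` U)) (g ` ?C)"
    have "image (image ?h) \<pi> \<in> nc_partitions lt (unsplit (?h ` g ` U)) (?h ` g ` ?C)"
    proof (rule nc_partitions_image[OF P])
      show "inj_on ?h (g ` ?C)" by (rule inj_on_inv_into) simp
      show "g ` U \<subseteq> g ` ?C" by auto
      fix x y assume "x \<in> g ` ?C" "y \<in> g ` ?C"
      thus "lt (?h x) (?h y) \<longleftrightarrow> lt' x y"
        using lt[of "?h x" "?h y"] inv_into_into[of x g ?C] inv_into_into[of y g ?C]
        by (simp add: f_inv_into_f)
    qed
    thus "image (image ?h) \<pi> \<in> nc_partitions lt (unsplit U) ?C"
      by (simp only: hg[of U] hg[of ?C] Un_upper1 subset_refl)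
    have "(\<lambda>B. g ` ?h ` B) ` \<pi> = id ` \<pi>"
      using sub[OF P] by (intro image_cong refl) (simp add: gh)
    thus "image (image g) (image (image ?h) \<pi>) = \<pi>" by (simp add: image_image)
  qed
  thus ?thesis by (simp add: ncsum_def image_Un)
qed

text \<open>If no point of \<open>E\<close> lies between two points of \<open>D\<close>, then a block inside \<open>D\<close> cannot cross a block
  inside \<open>E\<close>, whatever the two partitions are; so they can be chosen independently.\<close>

lemma sum_nc_partitions_split:
  fixes f :: "nat set \<Rightarrow> complex"
  assumes fin: "finite D" "finite E" and disj: "D \<inter> E = {}"
    and hull: "\<And>d d' e. d \<in> D \<Longrightarrow> d' \<in> D \<Longrightarrow> e \<in> E \<Longrightarrow> \<not> (d < e \<and> e < d')"
  shows "(\<Sum>\<pi>\<in>nc_partitions (<) (\<lambda>B. q B \<and> (B \<subseteq> D \<or> B \<subseteq> E)) (D \<union> E). \<Prod>B\<in>\<pi>. f B) =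
    (\<Sum>\<pi>\<in>nc_partitions (<) q D. \<Prod>B\<in>\<pi>. f B) * (\<Sum>\<pi>\<in>nc_partitions (<) q E. \<Prod>B\<in>\<pi>. f B)"
proof -
  let ?S = "nc_partitions (<) (\<lambda>B. q B \<and> (B \<subseteq> D \<or> B \<subseteq> E)) (D \<union> E)"
  let ?PD = "nc_partitions (<) q D" and ?PE = "nc_partitions (<) q E"
  have "(\<Sum>\<pi>\<in>?PD. \<Prod>B\<in>\<pi>. f B) * (\<Sum>\<pi>\<in>?PE. \<Prod>B\<in>\<pi>. f B) =
        (\<Sum>(\<sigma>, \<tau>)\<in>?PD \<times> ?PE. (\<Prod>B\<in>\<sigma>. f B) * (\<Prod>B\<in>\<tau>. f B))"
    by (simp add: sum_product sum.cartesian_product)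
  also have "\<dots> = (\<Sum>\<pi>\<in>?S. \<Prod>B\<in>\<pi>. f B)"
  proof (rule sum.reindex_bij_witness[where j = "\<lambda>(\<sigma>, \<tau>). \<sigma> \<union> \<tau>"
        and i = "\<lambda>\<pi>. ({B\<in>\<pi>. B \<subseteq> D}, {B\<in>\<pi>. B \<subseteq> E})"])
    fix x assume "x \<in> ?PD \<times> ?PE"
    then obtain \<sigma> \<tau> where x: "x = (\<sigma>, \<tau>)" and s: "\<sigma> \<in> ?PD" and t: "\<tau> \<in> ?PE" by blast
    have sp: "\<Union>\<sigma> = D" "{} \<notin> \<sigma>" and tp: "\<Union>\<tau> = E" "{} \<notin> \<tau>"
      and qs: "\<And>B. B \<in> \<sigma> \<union> \<tau> \<Longrightarrow> q B"
      using s t by (auto simp: nc_partitions_def partition_on_def)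
    have notboth: "B = {}" if "B \<subseteq> D" "B \<subseteq> E" for B using that disj by blast
    have sD: "B \<subseteq> D" "B \<noteq> {}" "\<not> B \<subseteq> E" if "B \<in> \<sigma>" for B
      using that sp notboth[of B] by auto
    have tE: "B \<subseteq> E" "B \<noteq> {}" "\<not> B \<subseteq> D" if "B \<in> \<tau>" for B
      using that tp notboth[of B] by auto
    have "B \<in> \<sigma> \<union> \<tau> \<and> B \<subseteq> D \<longleftrightarrow> B \<in> \<sigma>" "B \<in> \<sigma> \<union> \<tau> \<and> B \<subseteq> E \<longleftrightarrow> B \<in> \<tau>" for B
      using sD[of B] tE[of B] by auto
    hence "{B \<in> \<sigma> \<union> \<tau>. B \<subseteq> D} = \<sigma>" "{B \<in> \<sigma> \<union> \<tau>. B \<subseteq> E} = \<tau>"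
      by simp_all
    thus "({B \<in> (case x of (\<sigma>, \<tau>) \<Rightarrow> \<sigma> \<union> \<tau>). B \<subseteq> D},
        {B \<in> (case x of (\<sigma>, \<tau>) \<Rightarrow> \<sigma> \<union> \<tau>). B \<subseteq> E}) = x"
      by (simp add: x)
    have "\<sigma> \<inter> \<tau> = {}" using sD tE by blast
    moreover have "finite \<sigma>" "finite \<tau>"
      using s t fin by (auto simp: nc_partitions_def intro: finite_elements)
    ultimately show "(\<Prod>B\<in>(case x of (\<sigma>, \<tau>) \<Rightarrow> \<sigma> \<union> \<tau>). f B) =
        (case x of (\<sigma>, \<tau>) \<Rightarrow> (\<Prod>B\<in>\<sigma>. f B) * (\<Prod>B\<in>\<tau>. f B))"
      by (simp add: x prod.union_disjoint)
    have "noncrossing (<) (\<sigma> \<union> \<tau>)"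
      unfolding noncrossing_def
    proof (intro ballI impI, elim conjE)
      fix V W i j k l
      assume V: "V \<in> \<sigma> \<union> \<tau>" and W: "W \<in> \<sigma> \<union> \<tau>" and el: "i \<in> V" "j \<in> W" "k \<in> V" "l \<in> W"
        and lt: "i < j" "j < k" "k < l"
      have ncs: "noncrossing (<) \<sigma>" "noncrossing (<) \<tau>"
        using s t by (auto simp: nc_partitions_def)
      consider "V \<in> \<sigma>" "W \<in> \<sigma>" | "V \<in> \<tau>" "W \<in> \<tau>" | "V \<in> \<sigma>" "W \<in> \<tau>" | "V \<in> \<tau>" "W \<in> \<sigma>"
        using V W by blast
      thus "V = W"
      proof cases
        case 1 thus ?thesis using ncs(1) el lt unfolding noncrossing_def by blast
      next
        case 2 thus ?thesis using ncs(2) el lt unfolding noncrossing_def by blast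
      next
        case 3 thus ?thesis using hull[of i k j] el lt sD tE by blast
      next
        case 4 thus ?thesis using hull[of j l k] el lt sD tE by blast
      qed
    qed
    moreover have "disjoint (\<sigma> \<union> \<tau>)"
      using s t disj by (intro disjoint_union) (auto simp: nc_partitions_def partition_on_def)
    ultimately show "(case x of (\<sigma>, \<tau>) \<Rightarrow> \<sigma> \<union> \<tau>) \<in> ?S"
      using sp tp qs sD tE by (auto simp: x nc_partitions_def partition_on_def)
  next
    fix \<pi> assume p: "\<pi> \<in> ?S"
    hence "B \<subseteq> D \<or> B \<subseteq> E" if "B \<in> \<pi>" for B using that by (auto simp: nc_partitions_def)
    thus "(case ({B \<in> \<pi>. B \<subseteq> D}, {B \<in> \<pi>. B \<subseteq> E}) of (\<sigma>, \<tau>) \<Rightarrow> \<sigma> \<union> \<tau>) = \<pi>" by auto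
    have U: "\<Union>\<pi> = D \<union> E" and de: "\<And>B. B \<in> \<pi> \<Longrightarrow> B \<subseteq> D \<or> B \<subseteq> E"
      and dj: "disjoint \<pi>" and ne: "{} \<notin> \<pi>" and nc: "noncrossing (<) \<pi>"
      and qB: "\<And>B. B \<in> \<pi> \<Longrightarrow> q B"
      using p by (auto simp: nc_partitions_def partition_on_def)
    have "x \<in> \<Union>{B \<in> \<pi>. B \<subseteq> D}" if x: "x \<in> D" for x
    proof -
      obtain B where B: "B \<in> \<pi>" "x \<in> B" using x U by blast
      hence "B \<subseteq> D" using de[of B] x disj by blast
      thus ?thesis using B by blast
    qed
    moreover have "x \<in> \<Union>{B \<in> \<pi>. B \<subseteq> E}" if x: "x \<in> E" for x
    proof -
      obtain B where B: "B \<in> \<pi>" "x \<in> B" using x U by blast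
      hence "B \<subseteq> E" using de[of B] x disj by blast
      thus ?thesis using B by blast
    qed
    ultimately have "\<Union>{B \<in> \<pi>. B \<subseteq> D} = D" "\<Union>{B \<in> \<pi>. B \<subseteq> E} = E"
      by blast+
    moreover have "disjoint {B \<in> \<pi>. B \<subseteq> X}" "noncrossing (<) {B \<in> \<pi>. B \<subseteq> X}" for X
      using dj nc by (auto simp: disjoint_def noncrossing_def)
    ultimately show "({B \<in> \<pi>. B \<subseteq> D}, {B \<in> \<pi>. B \<subseteq> E}) \<in> ?PD \<times> ?PE"
      using ne qB by (auto simp: nc_partitions_def partition_on_def)
  qed
  finally show ?thesis by simp
qed

lemma nc_partitions_unsplit_self:
  assumes "U \<noteq> {}"
  shows "nc_partitions lt (unsplit U) U = {{U}}"
proof -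
  have "\<pi> = {U}" if p: "partition_on U \<pi>" and u: "\<forall>B\<in>\<pi>. unsplit U B" for \<pi>
  proof -
    have "B = U" if B: "B \<in> \<pi>" for B
    proof -
      have "B \<subseteq> U" "B \<noteq> {}" using p B by (auto simp: partition_on_def)
      moreover have "B \<inter> U = {} \<or> U \<subseteq> B" using u B by (auto simp: unsplit_def)
      ultimately show ?thesis by blast
    qed
    moreover have "\<pi> \<noteq> {}" using p assms by (auto simp: partition_on_def)
    ultimately show ?thesis by blast
  qed
  thus ?thesis
    using assms by (auto simp: nc_partitions_def unsplit_def partition_on_def noncrossing_def disjoint_def)
qed

text \<open>The first summand collects the partitions with \<open>U\<close> as a block. Otherwise let \<open>v\<close> be the least
  point that the block of \<open>U\<close> has outside \<open>U\<close>. A block that meets the gap before \<open>v\<close> stays in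
  the gap, since it would cross the block of \<open>U\<close> otherwise, and the remaining points form a sum of
  the same kind with \<open>v\<close> added to \<open>U\<close>.\<close>

lemma ncsum_step:
  assumes fin: "finite U" "finite A" and ne: "U \<noteq> {}"
    and below: "\<And>u x. u \<in> U \<Longrightarrow> x \<in> A \<Longrightarrow> u < x"
  shows "ncsum (<) f U A = f U * ncsum (<) f {} A +
    (\<Sum>v\<in>A. ncsum (<) f {} {x\<in>A. x < v} * ncsum (<) f (insert v U) {x\<in>A. v < x})"
proof -
  obtain u where u: "u \<in> U" using ne by blast
  define X E where "X v = {x\<in>A. x < v}" and "E v = insert v U \<union> {x\<in>A. v < x}" for v
  define S where "S = nc_partitions (<) (unsplit U) (U \<union> A)"
  \<comment> \<open>the block of \<open>U\<close> is \<open>U\<close> itself, or its next point is \<open>v\<close>; both families have the form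
    required by \<open>sum_nc_partitions_split\<close>\<close>
  define S0 where "S0 = nc_partitions (<) (\<lambda>B. unsplit U B \<and> (B \<subseteq> U \<or> B \<subseteq> A)) (U \<union> A)"
  define Sv where "Sv v = nc_partitions (<)
    (\<lambda>B. unsplit (insert v U) B \<and> (B \<subseteq> X v \<or> B \<subseteq> E v)) (X v \<union> E v)" for v
  have XE: "X v \<union> E v = U \<union> A" if "v \<in> A" for v
    using that by (auto simp: X_def E_def)
  have UA: "U \<inter> A = {}" using below by force

  have "S = S0 \<union> (\<Union>v\<in>A. Sv v)"
  proof (intro equalityI subsetI)
    fix \<pi> assume "\<pi> \<in> S0 \<union> (\<Union>v\<in>A. Sv v)"
    thus "\<pi> \<in> S"
      by (auto simp: S_def S0_def Sv_def nc_partitions_def XE unsplit_def)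
  next
    fix \<pi> assume p: "\<pi> \<in> S"
    hence part: "\<Union>\<pi> = U \<union> A" "disjoint \<pi>" and nc: "noncrossing (<) \<pi>"
      and un: "\<And>B. B \<in> \<pi> \<Longrightarrow> unsplit U B"
      by (auto simp: S_def nc_partitions_def partition_on_def)
    obtain V where V: "V \<in> \<pi>" "u \<in> V" using part u by blast
    have UV: "U \<subseteq> V" using un[OF V(1)] V(2) u by (auto simp: unsplit_def)
    have other: "B \<inter> V = {}" if "B \<in> \<pi>" "B \<noteq> V" for B
      using part(2) that V(1) by (auto simp: disjoint_def)
    show "\<pi> \<in> S0 \<union> (\<Union>v\<in>A. Sv v)"
    proof (cases "V = U")
      case True
      hence "B \<subseteq> U \<or> B \<subseteq> A" if "B \<in> \<pi>" for B
        using that other[of B] part(1) by blast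
      thus ?thesis using p by (auto simp: S_def S0_def nc_partitions_def)
    next
      case False
      define v where "v = Min (V - U)"
      have VA: "V - U \<subseteq> A" "V - U \<noteq> {}" using V part(1) UV False by auto
      have finV: "finite (V - U)" using VA fin finite_subset by blast
      have v: "v \<in> V" "v \<in> A" "v \<notin> U"
        using Min_in[OF finV VA(2)] VA by (auto simp: v_def)
      have vmin: "v \<le> x" if "x \<in> V" "x \<notin> U" for x
        unfolding v_def using finV that by (intro Min_le) auto
      have "unsplit (insert v U) B \<and> (B \<subseteq> X v \<or> B \<subseteq> E v)" if B: "B \<in> \<pi>" for B
      proof (cases "B = V")
        case True
        have "V \<subseteq> E v"
        proof
          fix x assume x: "x \<in> V"
          show "x \<in> E v"
            using vmin[OF x] VA x by (cases "x \<in> U") (auto simp: E_def le_less)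
        qed
        thus ?thesis using True UV v by (auto simp: unsplit_def)
      next
        case False
        have BV: "B \<inter> V = {}" using other B False by blast
        have "B \<subseteq> X v \<or> B \<subseteq> E v"
        proof (rule ccontr)
          assume "\<not> (B \<subseteq> X v \<or> B \<subseteq> E v)"
          then obtain x y where xy: "x \<in> B" "x \<notin> E v" "y \<in> B" "y \<notin> X v" by blast
          have "x \<in> U \<union> A" "y \<in> U \<union> A" using xy B part(1) by blast+
          hence x: "x \<in> A" "x < v" and y: "y \<in> A" "v < y"
            using xy BV UV v by (auto simp: X_def E_def)
          have "V = B"
            using nc V(1) B V(2) xy(1) v(1) xy(3) below[OF u x(1)] x(2) y(2)
            unfolding noncrossing_def by blast
          thus False using False by simp
        qed
        thus ?thesis using BV UV v by (auto simp: unsplit_def)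
      qed
      hence "\<pi> \<in> Sv v" using p v by (auto simp: S_def Sv_def nc_partitions_def XE)
      thus ?thesis using v by blast
    qed
  qed
  moreover have "finite S0" "\<And>v. finite (Sv v)"
    using fin by (auto simp: S0_def Sv_def X_def E_def intro!: finite_nc_partitions)
  moreover have "S0 \<inter> (\<Union>v\<in>A. Sv v) = {}"
  proof -
    have False if s0: "\<pi> \<in> S0" and "v \<in> A" "\<pi> \<in> Sv v" for \<pi> v
    proof -
      obtain V where V: "V \<in> \<pi>" "u \<in> V"
        using s0 u unfolding S0_def nc_partitions_def partition_on_def by blast
      have "V \<subseteq> U" using that(1) V u UA by (auto simp: S0_def nc_partitions_def)
      moreover have "v \<in> V" using that(3) V u by (auto simp: Sv_def nc_partitions_def unsplit_def)
      ultimately show False using that(2) UA by blast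
    qed
    thus ?thesis by blast
  qed
  moreover have "Sv v \<inter> Sv w = {}" if "v \<in> A" "w \<in> A" "v \<noteq> w" for v w
  proof -
    have False if "\<pi> \<in> Sv v" and sw: "\<pi> \<in> Sv w" and "v \<in> A" and w: "w \<in> A" and "v < w" for \<pi> v w
    proof -
      obtain V where V: "V \<in> \<pi>" "u \<in> V"
        using sw u XE[OF w] unfolding Sv_def nc_partitions_def partition_on_def by blast
      have "v \<in> V" using that(1) V u by (auto simp: Sv_def nc_partitions_def unsplit_def)
      moreover have "u \<notin> X w" using u UA by (auto simp: X_def)
      hence "V \<subseteq> E w" using that(2) V by (auto simp: Sv_def nc_partitions_def)
      moreover have "v \<notin> U" using that UA by blast
      ultimately show False using that(5) by (auto simp: E_def)
    qed
    thus ?thesis using that by (metis disjoint_iff nat_neq_iff)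
  qed
  ultimately have "ncsum (<) f U A =
      (\<Sum>\<pi>\<in>S0. \<Prod>B\<in>\<pi>. f B) + (\<Sum>v\<in>A. \<Sum>\<pi>\<in>Sv v. \<Prod>B\<in>\<pi>. f B)"
    using fin unfolding ncsum_def S_def[symmetric]
    by (simp add: sum.union_disjoint sum.UNION_disjoint)
  also have "(\<Sum>\<pi>\<in>S0. \<Prod>B\<in>\<pi>. f B) = f U * ncsum (<) f {} A"
  proof -
    have "(\<Sum>\<pi>\<in>S0. \<Prod>B\<in>\<pi>. f B) = (\<Sum>\<pi>\<in>nc_partitions (<) (unsplit U) U. \<Prod>B\<in>\<pi>. f B) *
        (\<Sum>\<pi>\<in>nc_partitions (<) (unsplit U) A. \<Prod>B\<in>\<pi>. f B)"
      unfolding S0_def using fin UA below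
      by (intro sum_nc_partitions_split) (auto dest: less_asym)
    moreover have "nc_partitions (<) (unsplit U) A = nc_partitions (<) (unsplit {}) A"
      using UA by (intro nc_partitions_cong) (auto simp: unsplit_def)
    ultimately show ?thesis
      using ne by (simp add: ncsum_def nc_partitions_unsplit_self)
  qed
  also have "(\<Sum>\<pi>\<in>Sv v. \<Prod>B\<in>\<pi>. f B) =
      ncsum (<) f {} {x\<in>A. x < v} * ncsum (<) f (insert v U) {x\<in>A. v < x}" if "v \<in> A" for v
  proof -
    have "(\<Sum>\<pi>\<in>Sv v. \<Prod>B\<in>\<pi>. f B) =
        (\<Sum>\<pi>\<in>nc_partitions (<) (unsplit (insert v U)) (X v). \<Prod>B\<in>\<pi>. f B) *
        (\<Sum>\<pi>\<in>nc_partitions (<) (unsplit (insert v U)) (E v). \<Prod>B\<in>\<pi>. f B)"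
      unfolding Sv_def using fin UA below
      by (intro sum_nc_partitions_split) (auto simp: X_def E_def dest: less_asym)
    moreover have "nc_partitions (<) (unsplit (insert v U)) (X v) = nc_partitions (<) (unsplit {}) (X v)"
      using UA by (intro nc_partitions_cong) (auto simp: unsplit_def X_def)
    ultimately show ?thesis by (simp add: ncsum_def X_def E_def)
  qed
  hence "(\<Sum>v\<in>A. \<Sum>\<pi>\<in>Sv v. \<Prod>B\<in>\<pi>. f B) =
      (\<Sum>v\<in>A. ncsum (<) f {} {x\<in>A. x < v} * ncsum (<) f (insert v U) {x\<in>A. v < x})"
    by (intro sum.cong refl)
  finally show ?thesis .
qed

text \<open>A single point is never split, so it may serve as the initial part of its own block.\<close>

lemma ncsum_insert: "ncsum lt f {} (insert x A) = ncsum lt f {x} A"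
proof -
  have "nc_partitions lt (unsplit {}) (insert x A) = nc_partitions lt (unsplit {x}) (insert x A)"
    by (intro nc_partitions_cong) (auto simp: unsplit_def)
  thus ?thesis by (simp add: ncsum_def)
qed

lemma ncsum_empty: "ncsum lt f {} {} = 1"
proof -
  have "nc_partitions lt (unsplit {}) {} = {{}}"
    by (auto simp: nc_partitions_def partition_on_empty noncrossing_def)
  thus ?thesis by (simp add: ncsum_def)
qed

section \<open>Weights that depend on the faces\<close>

text \<open>The points below \<open>N\<close> are the left ones.\<close>

definition face_weight :: "(nat \<Rightarrow> nat \<Rightarrow> complex) \<Rightarrow> nat \<Rightarrow> nat set \<Rightarrow> complex" where
  "face_weight k N B = k (card (B \<inter> {..<N})) (card (B \<inter> {N..}))"

text \<open>The sum in which the block under construction has \<open>p\<close> left and \<open>q\<close> right points so far, and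
  \<open>n\<close> left and \<open>m\<close> right points are still free. Right points follow left ones, so only the cases
  \<open>q = 0\<close> and \<open>n = 0\<close> are meaningful. If \<open>k\<close> gives the cumulants and \<open>p = q = 0\<close>, the sum is the
  moment of a word.\<close>

definition face_sum :: "(nat \<Rightarrow> nat \<Rightarrow> complex) \<Rightarrow> nat \<Rightarrow> nat \<Rightarrow> nat \<Rightarrow> nat \<Rightarrow> complex" where
  "face_sum k p q n m = ncsum (<) (face_weight k (p + n)) {..<p + q} {p + q..<p + q + n + m}"

text \<open>The points are replaced by their ranks. Both \<open>U\<close> and the set of left points are initial
  segments, so the four cardinalities determine the picture.\<close>

lemma ncsum_eq_face_sum:
  assumes fin: "finite U" "finite A" and below: "\<And>u x. u \<in> U \<Longrightarrow> x \<in> A \<Longrightarrow> u < x"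
    and card: "card (U \<inter> {..<N}) = p" "card (U \<inter> {N..}) = q"
      "card (A \<inter> {..<N}) = n" "card (A \<inter> {N..}) = m"
  shows "ncsum (<) (face_weight k N) U A = face_sum k p q n m"
proof -
  define C where "C = U \<union> A"
  \<comment> \<open>the rank function of \<open>C\<close>\<close>
  define g where "g x = card {y\<in>C. y < x}" for x
  have finC: "finite C" using fin by (simp add: C_def)
  have mono: "g x < g y" if "x \<in> C" "x < y" for x y
    unfolding g_def using that finC by (intro psubset_card_mono) auto
  have lt: "g x < g y \<longleftrightarrow> x < y" if "x \<in> C" "y \<in> C" for x y
    using mono[of x y] mono[of y x] that by (metis less_asym nat_neq_iff)
  have inj: "inj_on g C"
    using mono by (metis inj_onI less_irrefl nat_neq_iff)
  \<comment> \<open>ranks identify an initial segment of \<open>C\<close> with an initial segment of the naturals\<close>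
  have down: "g x < card D \<longleftrightarrow> x \<in> D"
    if D: "D \<subseteq> C" "\<forall>d\<in>D. \<forall>y\<in>C. y < d \<longrightarrow> y \<in> D" and x: "x \<in> C" for D x
  proof
    assume "x \<in> D"
    hence "{y\<in>C. y < x} \<subset> D" using D by blast
    moreover have "finite D" using D(1) finC by (rule finite_subset)
    ultimately show "g x < card D" unfolding g_def by (intro psubset_card_mono)
  next
    assume *: "g x < card D"
    show "x \<in> D"
    proof (rule ccontr)
      assume "x \<notin> D"
      have "d < x" if d: "d \<in> D" for d
        using D(2) d x \<open>x \<notin> D\<close> by (metis nat_neq_iff)
      hence "D \<subseteq> {y\<in>C. y < x}" using D(1) by blast
      hence "card D \<le> g x" unfolding g_def using finC by (intro card_mono) auto
      thus False using * by simp
    qed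
  qed
  have img: "g ` D = {..<card D}" if D: "D \<subseteq> C" "\<forall>d\<in>D. \<forall>y\<in>C. y < d \<longrightarrow> y \<in> D" for D
  proof (rule card_subset_eq)
    have "g x < card D" if "x \<in> D" for x
      using down[OF D, of x] D(1) that by blast
    thus "g ` D \<subseteq> {..<card D}" by auto
    show "card (g ` D) = card {..<card D}"
      using D inj by (simp add: card_image inj_on_subset)
  qed simp
  have cardsplit: "card B = card (B \<inter> {..<N}) + card (B \<inter> {N..})" if "finite B" for B :: "nat set"
    using that by (subst card_Un_disjoint[symmetric]) (auto intro!: arg_cong[where f = card])
  have cU: "card U = p + q" and cA: "card A = n + m"
    using cardsplit[OF fin(1)] cardsplit[OF fin(2)] card by simp_all
  have UA: "U \<inter> A = {}" using below by force
  have cC: "card C = p + q + n + m"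
    unfolding C_def using fin UA cU cA by (simp add: card_Un_disjoint)
  have gU: "g ` U = {..<p + q}"
  proof -
    have "\<forall>d\<in>U. \<forall>y\<in>C. y < d \<longrightarrow> y \<in> U"
    proof (intro ballI impI)
      fix d y assume "d \<in> U" "y \<in> C" "y < d"
      thus "y \<in> U" using below[of d y] by (auto simp: C_def)
    qed
    from img[OF _ this] have "g ` U = {..<card U}" by (auto simp: C_def)
    thus ?thesis by (simp only: cU)
  qed
  have gA: "g ` A = {p + q..<p + q + n + m}"
  proof -
    have "A = C - U" using UA by (auto simp: C_def)
    hence "g ` A = g ` C - g ` U"
      using inj_on_image_set_diff[OF inj, of C U] by (auto simp: C_def)
    also have "\<dots> = {p + q..<p + q + n + m}"
    proof -
      have "g ` C = {..<card C}" by (rule img) auto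
      thus ?thesis unfolding gU cC by auto
    qed
    finally show ?thesis .
  qed
  have "C \<inter> {..<N} = (U \<inter> {..<N}) \<union> (A \<inter> {..<N})" by (auto simp: C_def)
  hence cN: "card (C \<inter> {..<N}) = p + n"
    using fin card UA by (simp add: card_Un_disjoint Int_ac disjoint_iff)
  have gN: "g x < p + n \<longleftrightarrow> x < N" if "x \<in> C" for x
  proof -
    have "g x < card (C \<inter> {..<N}) \<longleftrightarrow> x \<in> C \<inter> {..<N}"
      using that by (intro down) auto
    thus ?thesis using that by (simp add: cN)
  qed
  have "ncsum (<) (face_weight k (p + n)) (g ` U) (g ` A) = ncsum (<) (face_weight k N) U A"
  proof (rule ncsum_reindex)
    fix B assume "B \<subseteq> U \<union> A"
    hence B: "B \<subseteq> C" by (simp add: C_def)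
    have "g ` B \<inter> {..<p + n} = g ` (B \<inter> {..<N})" "g ` B \<inter> {p + n..} = g ` (B \<inter> {N..})"
      using B gN by (auto simp: subset_eq image_iff not_less[symmetric])
    moreover have "inj_on g (B \<inter> Y)" for Y using inj B by (meson inf.coboundedI1 inj_on_subset)
    ultimately show "face_weight k (p + n) (g ` B) = face_weight k N B" by (simp add: face_weight_def card_image)
  qed (use inj lt in \<open>auto simp: C_def\<close>)
  thus ?thesis by (simp add: gU gA face_sum_def)
qed

lemma face_sum_Suc_left: "face_sum k 0 0 (Suc n) m = face_sum k 1 0 n m"
proof -
  have e: "{0..<Suc (n + m)} = insert 0 {1..<Suc (n + m)}" by auto
  show ?thesis unfolding face_sum_def
    by (simp add: e ncsum_insert lessThan_Suc)
qed

lemma face_sum_0: "face_sum k 0 0 0 0 = 1"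
  by (simp add: face_sum_def ncsum_empty)

text \<open>This is \<open>ncsum_step\<close> with every sum on the right named by its numbers of points: the next
  point of the block is either the left point with \<open>i\<close> left points before it, or the right point
  that has \<open>j\<close> right points and all free left points before it.\<close>

lemma face_sum_step:
  assumes pq: "0 < p + q" and qn: "q = 0 \<or> n = 0"
  shows "face_sum k p q n m = k p q * face_sum k 0 0 n m +
    (\<Sum>i<n. face_sum k 0 0 i 0 * face_sum k (Suc p) q (n - 1 - i) m) +
    (\<Sum>j<m. face_sum k 0 0 n j * face_sum k p (Suc q) 0 (m - 1 - j))"
proof -
  define U A where "U = {..<p + q}" and "A = {p + q..<p + q + n + m}"
  let ?f = "face_weight k (p + n)"
  let ?t = "\<lambda>v. ncsum (<) ?f {} {x\<in>A. x < v} * ncsum (<) ?f (insert v U) {x\<in>A. v < x}"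
  have U1: "U \<inter> {..<p + n} = {..<p}" and U2: "U \<inter> {p + n..} = {p..<p + q}"
    using qn by (auto simp: U_def)
  have A1: "A \<inter> {..<p + n} = {p + q..<p + q + n}"
    and A2: "A \<inter> {p + n..} = {p + q + n..<p + q + n + m}"
    using qn by (auto simp: A_def)
  have "face_sum k p q n m = ncsum (<) ?f U A" by (simp add: face_sum_def U_def A_def)
  also have "\<dots> = ?f U * ncsum (<) ?f {} A + (\<Sum>v\<in>A. ?t v)"
    using pq by (intro ncsum_step) (auto simp: U_def A_def)
  also have "?f U = k p q" by (simp add: face_weight_def U1 U2)
  also have "ncsum (<) ?f {} A = face_sum k 0 0 n m"
    by (rule ncsum_eq_face_sum) (simp_all add: A1 A2, simp add: A_def)
  also have "(\<Sum>v\<in>A. ?t v) = (\<Sum>v\<in>{p + q..<p + q + n}. ?t v) + (\<Sum>v\<in>{p + q + n..<p + q + n + m}. ?t v)"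
    unfolding A_def by (rule sum.atLeastLessThan_concat[symmetric]) auto
  also have "(\<Sum>v\<in>{p + q..<p + q + n}. ?t v) = (\<Sum>i<n. ?t (p + q + i))"
    by (rule sum.reindex_bij_witness[where i = "\<lambda>i. p + q + i" and j = "\<lambda>v. v - (p + q)"]) auto
  also have "\<dots> = (\<Sum>i<n. face_sum k 0 0 i 0 * face_sum k (Suc p) q (n - 1 - i) m)"
  proof (rule sum.cong[OF refl])
    fix i assume "i \<in> {..<n}"
    hence i: "i < n" and q: "q = 0" using qn by auto
    have l: "{x\<in>A. x < p + q + i} = {p..<p + i}" and r: "{x\<in>A. p + q + i < x} = {Suc (p + i)..<p + n + m}"
      using i q by (auto simp: A_def)
    have "ncsum (<) ?f {} {p..<p + i} = face_sum k 0 0 i 0"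
    proof (rule ncsum_eq_face_sum)
      have "{p..<p + i} \<inter> {..<p + n} = {p..<p + i}" "{p..<p + i} \<inter> {p + n..} = {}" using i by auto
      thus "card ({p..<p + i} \<inter> {..<p + n}) = i" "card ({p..<p + i} \<inter> {p + n..}) = 0" by simp_all
    qed auto
    moreover have "ncsum (<) ?f (insert (p + i) {..<p}) {Suc (p + i)..<p + n + m} =
        face_sum k (Suc p) 0 (n - 1 - i) m"
    proof (rule ncsum_eq_face_sum)
      have "insert (p + i) {..<p} \<inter> {..<p + n} = insert (p + i) {..<p}"
        "insert (p + i) {..<p} \<inter> {p + n..} = {}" using i by auto
      thus "card (insert (p + i) {..<p} \<inter> {..<p + n}) = Suc p"
        "card (insert (p + i) {..<p} \<inter> {p + n..}) = 0" by simp_all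
      have "{Suc (p + i)..<p + n + m} \<inter> {..<p + n} = {Suc (p + i)..<p + n}"
        "{Suc (p + i)..<p + n + m} \<inter> {p + n..} = {p + n..<p + n + m}" using i by auto
      thus "card ({Suc (p + i)..<p + n + m} \<inter> {..<p + n}) = n - 1 - i"
        "card ({Suc (p + i)..<p + n + m} \<inter> {p + n..}) = m" by simp_all
    qed auto
    ultimately show "?t (p + q + i) = face_sum k 0 0 i 0 * face_sum k (Suc p) q (n - 1 - i) m"
      unfolding l r by (simp add: U_def q)
  qed
  also have "(\<Sum>v\<in>{p + q + n..<p + q + n + m}. ?t v) = (\<Sum>j<m. ?t (p + q + n + j))"
    by (rule sum.reindex_bij_witness[where i = "\<lambda>i. p + q + n + i" and j = "\<lambda>v. v - (p + q + n)"]) auto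
  also have "\<dots> = (\<Sum>j<m. face_sum k 0 0 n j * face_sum k p (Suc q) 0 (m - 1 - j))"
  proof (rule sum.cong[OF refl])
    fix j assume "j \<in> {..<m}"
    hence j: "j < m" by auto
    define v where "v = p + q + n + j"
    have l: "{x\<in>A. x < v} = {p + q..<v}" and r: "{x\<in>A. v < x} = {Suc v..<p + q + n + m}"
      using j by (auto simp: A_def v_def)
    have "ncsum (<) ?f {} {p + q..<v} = face_sum k 0 0 n j"
    proof (rule ncsum_eq_face_sum)
      have "{p + q..<v} \<inter> {..<p + n} = {p + q..<p + q + n}" "{p + q..<v} \<inter> {p + n..} = {p + q + n..<v}"
        using j qn by (auto simp: v_def)
      thus "card ({p + q..<v} \<inter> {..<p + n}) = n" "card ({p + q..<v} \<inter> {p + n..}) = j"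
        by (simp_all add: v_def)
    qed auto
    moreover have "ncsum (<) ?f (insert v U) {Suc v..<p + q + n + m} = face_sum k p (Suc q) 0 (m - 1 - j)"
    proof (rule ncsum_eq_face_sum)
      have "insert v U \<inter> {..<p + n} = {..<p}" "insert v U \<inter> {p + n..} = insert v {p..<p + q}"
        using U1 U2 by (auto simp: v_def)
      thus "card (insert v U \<inter> {..<p + n}) = p" "card (insert v U \<inter> {p + n..}) = Suc q"
        by (simp_all add: v_def)
      have "{Suc v..<p + q + n + m} \<inter> {..<p + n} = {}"
        "{Suc v..<p + q + n + m} \<inter> {p + n..} = {Suc v..<p + q + n + m}" by (auto simp: v_def)
      thus "card ({Suc v..<p + q + n + m} \<inter> {..<p + n}) = 0"
        "card ({Suc v..<p + q + n + m} \<inter> {p + n..}) = m - 1 - j"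
        using j by (simp_all add: v_def)
    qed (auto simp: U_def v_def)
    ultimately show "?t (p + q + n + j) = face_sum k 0 0 n j * face_sum k p (Suc q) 0 (m - 1 - j)"
      unfolding v_def[symmetric] l r by simp
  qed
  finally show ?thesis by (simp add: add.assoc)
qed

section \<open>Substitution into series in two variables\<close>

definition fps_in_w :: "complex fps \<Rightarrow> complex fps fps" where
  "fps_in_w f = Abs_fps (\<lambda>m. fps_const (f $ m))"

definition compose_coeffs :: "complex fps \<Rightarrow> complex fps fps \<Rightarrow> complex fps fps" where
  "compose_coeffs g F = Abs_fps (\<lambda>m. F $ m oo g)"

text \<open>The substitution in two variables factors into one for \<open>z\<close>, applied to each coefficient, and an
  ordinary composition over the ring of power series in \<open>z\<close>. Both respect products, which reduces
  the calculus of \<open>fps2_compose\<close> to that of series in one variable.\<close>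

lemma fps2_compose_eq: "fps2_compose f g h = compose_coeffs g f oo fps_in_w h"
  by (simp add: fps2_compose_def compose_coeffs_def fps_in_w_def)

lemma fps_const_sum: "fps_const (sum f A) = (\<Sum>x\<in>A. fps_const (f x :: complex))"
  by (induction A rule: infinite_finite_induct) (simp_all flip: fps_const_add)

lemma fps_in_w_nth [simp]: "fps_in_w f $ m = fps_const (f $ m)"
  by (simp add: fps_in_w_def)

lemma fps_in_w_add: "fps_in_w (f + g) = fps_in_w f + fps_in_w g"
  and fps_in_w_1: "fps_in_w 1 = 1"
  and fps_in_w_X: "fps_in_w fps_X = fps_X"
  and fps_in_w_mult: "fps_in_w (f * g) = fps_in_w f * fps_in_w g"
  by (simp_all add: fps_eq_iff[where 'a = "complex fps"] fps_mult_nth fps_const_sum)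

lemma fps_in_w_power: "fps_in_w (f ^ n) = fps_in_w f ^ n"
  by (induction n) (simp_all add: fps_in_w_1 fps_in_w_mult)

lemma fps_in_w_compose: "fps_in_w (f oo g) = fps_in_w f oo fps_in_w g"
  by (rule fps_ext) (simp add: fps_compose_nth fps_const_sum flip: fps_in_w_power)

lemma compose_coeffs_nth [simp]: "compose_coeffs g F $ m = F $ m oo g"
  by (simp add: compose_coeffs_def)

lemma compose_coeffs_fps_in_w [simp]: "compose_coeffs g (fps_in_w f) = fps_in_w f"
  by (rule fps_ext) simp

lemma compose_coeffs_const [simp]: "compose_coeffs g (fps_const c) = fps_const (c oo g)"
  by (rule fps_ext) simp

lemma compose_coeffs_add: "compose_coeffs g (F + G) = compose_coeffs g F + compose_coeffs g G"
  by (rule fps_ext) (simp add: fps_compose_add_distrib)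

lemma compose_coeffs_mult:
  "g $ 0 = 0 \<Longrightarrow> compose_coeffs g (F * G) = compose_coeffs g F * compose_coeffs g G"
  by (rule fps_ext) (simp add: fps_mult_nth fps_compose_sum_distrib fps_compose_mult_distrib)

lemma compose_coeffs_compose_fps_in_w:
  assumes "g $ 0 = 0"
  shows "compose_coeffs g (F oo fps_in_w h) = compose_coeffs g F oo fps_in_w h"
  by (rule fps_ext)
    (simp add: fps_compose_nth fps_compose_sum_distrib fps_compose_mult_distrib[OF assms]
      flip: fps_in_w_power)

lemma compose_coeffs_compose_coeffs:
  assumes "g $ 0 = 0" "y $ 0 = 0"
  shows "compose_coeffs y (compose_coeffs g F) = compose_coeffs (g oo y) F"
  by (rule fps_ext) (simp add: fps_compose_assoc assms)

lemma fps2_compose_add: "fps2_compose (F + G) g h = fps2_compose F g h + fps2_compose G g h"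
  by (simp add: fps2_compose_eq compose_coeffs_add fps_compose_add_distrib)

lemma fps2_compose_const: "fps2_compose (fps_const c) g h = fps_const (c oo g)"
  by (simp add: fps2_compose_eq)

lemma fps2_compose_1: "fps2_compose 1 g h = 1"
  using fps2_compose_const[of 1 g h] by simp

lemma fps2_compose_fps_in_w: "fps2_compose (fps_in_w f) g h = fps_in_w (f oo h)"
  by (simp add: fps2_compose_eq fps_in_w_compose)

lemma fps2_compose_mult:
  assumes "g $ 0 = 0" "h $ 0 = 0"
  shows "fps2_compose (F * G) g h = fps2_compose F g h * fps2_compose G g h"
  using assms by (simp add: fps2_compose_eq compose_coeffs_mult fps_compose_mult_distrib)

lemma fps2_compose_fps2_compose:
  assumes "g $ 0 = 0" "h $ 0 = 0" "y $ 0 = 0" "x $ 0 = 0"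
  shows "fps2_compose (fps2_compose F g h) y x = fps2_compose F (g oo y) (h oo x)"
  using assms
  by (simp add: fps2_compose_eq compose_coeffs_compose_fps_in_w compose_coeffs_compose_coeffs
      fps_compose_assoc fps_in_w_compose)

lemma fps2_to_fls2_add: "fps2_to_fls2 (F + G) = fps2_to_fls2 F + fps2_to_fls2 G"
proof -
  have "Abs_fps (\<lambda>m. fps_to_fls ((F + G) $ m)) =
      Abs_fps (\<lambda>m. fps_to_fls (F $ m)) + Abs_fps (\<lambda>m. fps_to_fls (G $ m))"
    by (rule fps_ext) simp
  thus ?thesis by (simp add: fps2_to_fls2_def)
qed

lemma fps2_to_fls2_mult: "fps2_to_fls2 (F * G) = fps2_to_fls2 F * fps2_to_fls2 G"
proof -
  have fls_sum: "fps_to_fls (sum f A) = (\<Sum>x\<in>A. fps_to_fls (f x :: complex fps))"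
    for f :: "nat \<Rightarrow> complex fps" and A
    by (induction A rule: infinite_finite_induct) simp_all
  have "Abs_fps (\<lambda>m. fps_to_fls ((F * G) $ m)) =
      Abs_fps (\<lambda>m. fps_to_fls (F $ m)) * Abs_fps (\<lambda>m. fps_to_fls (G $ m))"
    by (rule fps_ext) (simp add: fps_mult_nth fls_sum fls_times_fps_to_fls)
  thus ?thesis by (simp add: fps2_to_fls2_def fls_times_fps_to_fls)
qed

lemma fps2_to_fls2_const: "fps2_to_fls2 (fps_const c) = fls_const (fps_to_fls c)"
proof -
  have "Abs_fps (\<lambda>m. fps_to_fls (fps_const c $ m)) = fps_const (fps_to_fls c)"
    by (rule fps_ext) simp
  thus ?thesis by (simp add: fps2_to_fls2_def)
qed

lemma fps2_to_fls2_X: "fps2_to_fls2 fps_X = fls_X"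
proof -
  have "Abs_fps (\<lambda>m. fps_to_fls (fps_X $ m :: complex fps)) = fps_X"
    by (rule fps_ext) simp
  thus ?thesis by (simp add: fps2_to_fls2_def)
qed

lemma fps2_to_fls2_1: "fps2_to_fls2 1 = 1"
  using fps2_to_fls2_const[of 1] by simp

section \<open>The functional equation for moments and cumulants\<close>

lemma fps_X_mult_mult_nth:
  fixes f g :: "'r::comm_ring_1 fps"
  shows "(fps_X * (f * g)) $ n = (\<Sum>i<n. f $ i * g $ (n - 1 - i))"
  unfolding fps_X_mult_nth
  by (cases n) (simp_all add: fps_mult_nth atLeast0AtMost lessThan_Suc_atMost)

text \<open>Uniqueness for recursions without a base case: unfolding \<open>D p\<close> repeatedly shows that it is
  divisible by every power of the variable.\<close>

lemma fps_contraction_zero: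
  fixes D :: "nat \<Rightarrow> complex fps"
  assumes D: "\<And>p. 0 < p \<Longrightarrow> D p = fps_X * (M * D (Suc p))" and "0 < p"
  shows "D p = 0"
proof -
  have "\<forall>p>0. D p $ n = 0" for n
  proof (induction n rule: less_induct)
    case (less n)
    have "D p $ n = 0" if "0 < p" for p
      by (subst D[OF that], subst fps_X_mult_mult_nth) (use less in auto)
    thus ?case by blast
  qed
  thus ?thesis using \<open>0 < p\<close> by (intro fps_ext) simp
qed

lemma fps_split_first: "Abs_fps u = fps_const (u 0) + fps_X * Abs_fps (\<lambda>n. u (Suc n) :: complex)"
  by (rule fps_ext) simp

context
  fixes k :: "nat \<Rightarrow> nat \<Rightarrow> complex"
begin

abbreviation "left_moments \<equiv> Abs_fps (\<lambda>n. face_sum k 0 0 n 0)"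
abbreviation "right_moments \<equiv> Abs_fps (\<lambda>m. face_sum k 0 0 0 m)"
abbreviation "joint_moments \<equiv> fps2 (\<lambda>n m. face_sum k 0 0 n m)"

text \<open>A block that has reached the right points is continued by right points only, and each further
  point costs \<open>w\<close> times the moment series of the gap that it closes; the remaining factor belongs
  to the gap after the last point.\<close>

lemma right_run_series:
  assumes "0 < p"
  shows "Abs_fps (\<lambda>m. face_sum k p (Suc 0) 0 m) =
    right_moments * (Abs_fps (\<lambda>j. k p (Suc j)) oo (fps_X * right_moments))"
proof -
  define V where "V q = Abs_fps (\<lambda>m. face_sum k p q 0 m)" for q
  \<comment> \<open>the claimed solution, which satisfies the same recursion as the series of sums\<close>
  define R where "R q = right_moments * (Abs_fps (\<lambda>j. k p (q + j)) oo (fps_X * right_moments))" for q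
  have V: "V q = fps_const (k p q) * right_moments + fps_X * (right_moments * V (Suc q))" for q
    by (rule fps_ext)
      (use assms in \<open>simp add: V_def fps_X_mult_mult_nth face_sum_step[of p q 0] del: fps_X_mult_nth\<close>)
  have R: "R q = fps_const (k p q) * right_moments + fps_X * (right_moments * R (Suc q))" for q
    unfolding R_def
    by (subst fps_split_first)
      (simp add: fps_compose_add_distrib fps_compose_mult_distrib algebra_simps)
  have "V (Suc 0) - R (Suc 0) = 0"
  proof (rule fps_contraction_zero[where D = "\<lambda>q. V q - R q"])
    fix q show "V q - R q = fps_X * (right_moments * (V (Suc q) - R (Suc q)))"
      by (subst V, subst R) (simp add: algebra_simps)
  qed simp
  thus ?thesis by (simp add: V_def R_def)
qed

text \<open>In the same way each left point after the first costs \<open>z\<close> and a gap of left points, while the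
  factor \<open>joint_moments\<close> comes from the gap that contains the passage from left to right, which
  lies behind the last left point.\<close>

lemma left_run_series:
  "fps2 (\<lambda>n m. face_sum k (Suc 0) 0 n m) =
     fps2_compose (fps2 (\<lambda>j q. k (Suc j) q)) (fps_X * left_moments) (fps_X * right_moments) *
     joint_moments"
proof -
  define D where "D p = fps2 (\<lambda>n m. face_sum k p 0 n m)" for p
  define K where "K p = fps2 (\<lambda>j q. k (p + j) q)" for p
  \<comment> \<open>the claimed solution\<close>
  define R where
    "R p = fps2_compose (K p) (fps_X * left_moments) (fps_X * right_moments) * joint_moments" for p
  \<comment> \<open>the partitions in which the block of \<open>U\<close> has exactly \<open>p\<close> left points\<close>
  define L where "L p = fps_in_w (Abs_fps (k p) oo (fps_X * right_moments)) * joint_moments" for p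
  have D: "D p = L p + fps_const (fps_X * left_moments) * D (Suc p)" if p: "0 < p" for p
  proof -
    have "Abs_fps (k p) oo (fps_X * right_moments) =
        fps_const (k p 0) + fps_X * Abs_fps (\<lambda>m. face_sum k p (Suc 0) 0 m)"
      by (subst fps_split_first)
        (simp add: fps_compose_add_distrib fps_compose_mult_distrib right_run_series[OF p] mult.assoc)
    hence L: "L p = fps_const (fps_const (k p 0)) * joint_moments +
        fps_X * (joint_moments * fps_in_w (Abs_fps (\<lambda>m. face_sum k p (Suc 0) 0 m)))"
      by (simp add: L_def fps_in_w_add fps_in_w_mult fps_in_w_X algebra_simps)
        (simp add: fps_in_w_def fps_eq_iff)
    show ?thesis
    proof (intro fps_ext)
      fix m n
      have "(fps_X * (joint_moments * fps_in_w (Abs_fps (\<lambda>m. face_sum k p (Suc 0) 0 m)))) $ m $ n =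
          (\<Sum>j<m. face_sum k 0 0 n j * face_sum k p (Suc 0) 0 (m - 1 - j))"
        by (simp add: fps_X_mult_mult_nth fps_sum_nth del: fps_X_mult_nth) (simp add: fps2_def)
      moreover have "(fps_const (fps_X * left_moments) * D (Suc p)) $ m $ n =
          (\<Sum>i<n. face_sum k 0 0 i 0 * face_sum k (Suc p) 0 (n - 1 - i) m)"
        by (simp add: mult.assoc fps_X_mult_mult_nth D_def fps2_def del: fps_X_mult_nth)
      ultimately show "D p $ m $ n = (L p + fps_const (fps_X * left_moments) * D (Suc p)) $ m $ n"
        using face_sum_step[of p 0 n k m] p unfolding L by (simp add: D_def fps2_def)
    qed
  qed
  have R: "R p = L p + fps_const (fps_X * left_moments) * R (Suc p)" for p
  proof -
    have "K p = fps_in_w (Abs_fps (k p)) + fps_const fps_X * K (Suc p)"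
      by (intro fps_ext) (simp add: K_def fps2_def)
    thus ?thesis
      by (simp add: R_def L_def fps2_compose_add fps2_compose_mult fps2_compose_fps_in_w
          fps2_compose_const algebra_simps)
  qed
  have "D (Suc 0) $ m - R (Suc 0) $ m = 0" for m
  proof (rule fps_contraction_zero[where D = "\<lambda>p. D p $ m - R p $ m"])
    fix p :: nat assume "0 < p"
    have "D p - R p = fps_const (fps_X * left_moments) * (D (Suc p) - R (Suc p))"
      by (subst D[OF \<open>0 < p\<close>], subst R) (simp add: algebra_simps)
    hence "(D p - R p) $ m = (fps_const (fps_X * left_moments) * (D (Suc p) - R (Suc p))) $ m"
      by simp
    thus "D p $ m - R p $ m = fps_X * (left_moments * (D (Suc p) $ m - R (Suc p) $ m))"
      by (simp add: mult.assoc)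
  qed simp
  hence "D (Suc 0) = R (Suc 0)" by (intro fps_ext) (simp add: fps_eq_iff)
  thus ?thesis by (simp add: D_def R_def K_def)
qed

lemma joint_moments_split:
  "joint_moments =
    fps_in_w right_moments + fps_const fps_X * fps2 (\<lambda>n m. face_sum k (Suc 0) 0 n m)"
proof (intro fps_ext)
  show "joint_moments $ m $ n = (fps_in_w right_moments +
      fps_const fps_X * fps2 (\<lambda>n m. face_sum k (Suc 0) 0 n m)) $ m $ n" for m n
    by (cases n) (simp_all add: fps2_def face_sum_Suc_left)
qed

text \<open>The case without right points, read off from the coefficient of \<open>w\<^sup>0\<close>. It says
  \<open>c\<^sub>a(z M\<^sub>a(z)) = M\<^sub>a(z) - 1\<close>.\<close>

lemma left_moments_functional_equation:
  "Abs_fps (\<lambda>n. if n = 0 then 0 else k n 0) oo (fps_X * left_moments) = left_moments - 1"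
proof -
  let ?c = "Abs_fps (\<lambda>n. k (Suc n) 0) oo (fps_X * left_moments)"
  have nth0: "fps2_compose F g h $ 0 = F $ 0 oo g" for F g h
    by (simp add: fps2_compose_eq)
  have H0: "joint_moments $ 0 = left_moments" by (simp add: fps2_def)
  have "joint_moments $ 0 = fps_in_w right_moments $ 0 +
      (fps_const fps_X * fps2 (\<lambda>n m. face_sum k (Suc 0) 0 n m)) $ 0"
    by (subst joint_moments_split) (rule fps_add_nth)
  also have "\<dots> = 1 + fps_X * (?c * left_moments)"
    unfolding left_run_series by (simp add: nth0 H0 face_sum_0) (simp add: fps2_def)
  finally have "left_moments = 1 + fps_X * left_moments * ?c" by (simp add: H0 mult_ac)
  moreover have "Abs_fps (\<lambda>n. if n = 0 then 0 else k n 0) oo (fps_X * left_moments) =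
      fps_X * left_moments * ?c"
    by (subst fps_split_first) (simp add: fps_compose_add_distrib fps_compose_mult_distrib)
  ultimately show ?thesis by (metis add_diff_cancel_left')
qed

text \<open>Splitting the series of all \<open>k p q\<close> with \<open>p \<ge> 1\<close> into the part with \<open>q = 0\<close> and the part with
  \<open>q \<ge> 1\<close>, the former becomes \<open>left_moments - 1\<close> by the preceding lemma and cancels the factor
  \<open>left_moments\<close> by which the recursion had to be multiplied.\<close>

lemma joint_moments_functional_equation:
  "joint_moments = fps_const left_moments * fps_in_w right_moments +
     fps2_compose (fps2 (\<lambda>n m. if n = 0 \<or> m = 0 then 0 else k n m))
       (fps_X * left_moments) (fps_X * right_moments) * joint_moments"
proof -
  define K where "K = fps2 (\<lambda>n m. if n = 0 \<or> m = 0 then 0 else k n m)"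
  define c where "c = Abs_fps (\<lambda>n. if n = 0 then 0 else k n 0)"
  define K1 where "K1 = fps2 (\<lambda>j q. k (Suc j) q)"
  let ?g = "fps_X * left_moments" and ?h = "fps_X * right_moments"
  have "fps_const fps_X * K1 = fps_const c + K"
    by (intro fps_ext) (simp add: K1_def K_def c_def fps2_def)
  hence "fps2_compose (fps_const fps_X * K1) ?g ?h = fps2_compose (fps_const c + K) ?g ?h" by simp
  hence K1: "fps_const ?g * fps2_compose K1 ?g ?h =
      fps_const (left_moments - 1) + fps2_compose K ?g ?h"
    using left_moments_functional_equation
    by (simp add: fps2_compose_mult fps2_compose_add fps2_compose_const c_def)
  have "joint_moments = fps_in_w right_moments +
      fps_const fps_X * (fps2_compose K1 ?g ?h * joint_moments)"
    by (subst joint_moments_split) (simp add: left_run_series K1_def)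
  hence "fps_const left_moments * joint_moments =
      fps_const left_moments * fps_in_w right_moments +
      fps_const ?g * fps2_compose K1 ?g ?h * joint_moments"
    by (metis (no_types, lifting) distrib_left fps_const_mult mult.assoc mult.left_commute)
  also have "\<dots> = fps_const left_moments * fps_in_w right_moments +
      (fps_const left_moments - 1 + fps2_compose K ?g ?h) * joint_moments"
    unfolding K1 by (simp flip: fps_const_sub)
  finally show ?thesis unfolding K_def[symmetric] by (simp add: algebra_simps)
qed

end


section \<open>Moments and cumulants of the pair\<close>

lemma sum_NC_eq_ncsum: "(\<Sum>\<pi>\<in>NC n. \<Prod>B\<in>\<pi>. f B) = ncsum (<) f {} {..<n}"
  by (simp add: ncsum_def nc_partitions_def NC_def unsplit_def)

lemma sum_BNC_eq_ncsum:
  "(\<Sum>\<pi>\<in>BNC \<chi>. \<Prod>B\<in>\<pi>. f B) = ncsum (chi_less \<chi>) f {} {..<length \<chi>}"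
  by (simp add: ncsum_def nc_partitions_def BNC_def unsplit_def)

text \<open>All points are taken to be left ones, so the cumulants of one variable are covered by the same
  functional equation as the cumulants of the pair.\<close>

lemma moment_eq_face_sum:
  assumes "\<phi> 1 = 1"
  shows "\<phi> (b ^ n) = face_sum (\<lambda>p q. free_cumulant \<phi> b p) 0 0 n 0"
proof (cases "n = 0")
  case False
  let ?k = "\<lambda>p q. free_cumulant \<phi> b p"
  have "\<phi> (b ^ n) = ncsum (<) (\<lambda>B. free_cumulant \<phi> b (card B)) {} {..<n}"
    using False by (simp add: moment_free_cumulant sum_NC_eq_ncsum)
  also have "\<dots> = ncsum (<) (face_weight ?k n) (id ` {}) (id ` {..<n})"
  proof (rule ncsum_reindex[symmetric])
    fix B assume "B \<subseteq> {} \<union> {..<n}"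
    hence "B \<inter> {..<n} = B" by auto
    thus "face_weight ?k n (id ` B) = free_cumulant \<phi> b (card B)" by (simp add: face_weight_def)
  qed auto
  finally show ?thesis by (simp add: face_sum_def atLeast0LessThan)
qed (simp add: face_sum_0 assms)

lemma nths_replicate: "nths (replicate n x) B = replicate (card (B \<inter> {..<n})) x"
proof (rule replicate_eqI)
  show "length (nths (replicate n x) B) = card (B \<inter> {..<n})"
    by (simp add: length_nths Int_def conj_commute)
qed (auto dest: in_set_nthsD)

lemma nths_replicate_append:
  assumes "B \<subseteq> {..<n + m}"
  shows "nths (replicate n x @ replicate m y) B =
    replicate (card (B \<inter> {..<n})) x @ replicate (card (B \<inter> {n..})) y"
proof -
  have "B \<inter> {n..} = (\<lambda>j. j + n) ` ({j. j + n \<in> B} \<inter> {..<m})"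
  proof (intro equalityI subsetI)
    fix i assume "i \<in> B \<inter> {n..}"
    thus "i \<in> (\<lambda>j. j + n) ` ({j. j + n \<in> B} \<inter> {..<m})"
      using assms by (intro image_eqI[of _ _ "i - n"]) auto
  qed auto
  hence "card (B \<inter> {n..}) = card ({j. j + n \<in> B} \<inter> {..<m})"
    by (simp add: card_image)
  thus ?thesis by (simp add: nths_append nths_replicate)
qed

text \<open>Reversing the order of the right points turns the order of bi-non-crossing partitions into the
  usual one.\<close>

lemma joint_moment_eq_face_sum:
  assumes "\<phi> 1 = 1"
  shows "\<phi> (a ^ n * b ^ m) = face_sum (kappa2 \<phi> a b) 0 0 n m"
proof (cases "n + m = 0")
  case False
  define \<chi> where "\<chi> = replicate n Lft @ replicate m Rgt"
  define as where "as = replicate n a @ replicate m b"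
  define f where "f B = lr_cumulant \<phi> (nths \<chi> B) (nths as B)" for B
  \<comment> \<open>fixes the left points and reverses the right points \<open>n, \<dots>, n + m - 1\<close>\<close>
  define g where "g i = (if i < n then i else 2 * n + m - 1 - i)" for i
  have len: "length \<chi> = n + m" by (simp add: \<chi>_def)
  have inv: "g (g i) = i" "g i < n + m" if "i < n + m" for i
    using that by (auto simp: g_def)
  have inj: "inj_on g {..<n + m}" by (rule inj_on_inverseI[of _ g]) (simp add: inv)
  have "g ` {..<n + m} = {..<n + m}"
    using inv by (auto intro!: image_eqI[of _ g "g _"])
  have "\<phi> (a ^ n * b ^ m) = \<phi> (prod_list as)" by (simp add: as_def prod_list_replicate)
  also have "\<dots> = ncsum (chi_less \<chi>) f {} {..<n + m}"
    using False
  proof -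
    have "\<phi> (prod_list as) = (\<Sum>\<pi>\<in>BNC \<chi>. \<Prod>B\<in>\<pi>. f B)"
      unfolding f_def using False by (intro moment_lr_cumulant) (auto simp: as_def \<chi>_def)
    thus ?thesis by (simp add: sum_BNC_eq_ncsum len)
  qed
  also have "\<dots> = ncsum (<) (face_weight (kappa2 \<phi> a b) n) (g ` {}) (g ` {..<n + m})"
  proof (rule ncsum_reindex[symmetric])
    show "inj_on g ({} \<union> {..<n + m})" using inj by simp
  next
    fix x y assume "x \<in> {} \<union> {..<n + m}" "y \<in> {} \<union> {..<n + m}"
    thus "g x < g y \<longleftrightarrow> chi_less \<chi> x y"
      by (auto simp: g_def chi_less_def \<chi>_def nth_append)
  next
    fix B assume "B \<subseteq> {} \<union> {..<n + m}"
    hence B: "B \<subseteq> {..<n + m}" by simp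
    have gn: "g i < n \<longleftrightarrow> i < n" if "i < n + m" for i
      using that by (auto simp: g_def)
    have "g ` B \<inter> {..<n} = g ` (B \<inter> {..<n})" "g ` B \<inter> {n..} = g ` (B \<inter> {n..})"
      using B gn by (auto simp: subset_eq image_iff not_less[symmetric])
    moreover have "inj_on g (B \<inter> Y)" for Y using inj B by (meson inf.coboundedI1 inj_on_subset)
    ultimately have "face_weight (kappa2 \<phi> a b) n (g ` B) =
        kappa2 \<phi> a b (card (B \<inter> {..<n})) (card (B \<inter> {n..}))"
      by (simp add: face_weight_def card_image)
    also have "\<dots> = f B"
      by (simp add: f_def \<chi>_def as_def kappa2_def nths_replicate_append[OF B])
    finally show "face_weight (kappa2 \<phi> a b) n (g ` B) = f B" .
  qed
  also have "\<dots> = face_sum (kappa2 \<phi> a b) 0 0 n m"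
    using \<open>g ` {..<n + m} = {..<n + m}\<close> by (simp add: face_sum_def atLeast0LessThan)
  finally show ?thesis .
qed (simp add: face_sum_0 assms)

lemma c_series_compose_right:
  assumes "\<phi> 1 = 1"
  shows "c_series \<phi> b oo (fps_X * (1 + psi_series \<phi> b)) = psi_series \<phi> b"
proof -
  have "left_moments (\<lambda>p q. free_cumulant \<phi> b p) = 1 + psi_series \<phi> b"
    by (rule fps_ext) (simp add: psi_series_def assms flip: moment_eq_face_sum[of \<phi>, OF assms])
  thus ?thesis
    using left_moments_functional_equation[of "\<lambda>p q. free_cumulant \<phi> b p"] by (simp add: c_series_def)
qed

text \<open>The functional equation of the joint moments, multiplied by \<open>z\<close>: written in the reciprocal
  variable, the Cauchy transform is \<open>z M\<^sub>a(z)\<close> and \<open>F\<close> is \<open>z H(z,w)\<close>.\<close>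

lemma F_series_functional_equation:
  fixes \<phi> :: "'a::ring_1 \<Rightarrow> complex" and a b :: 'a
  assumes "\<phi> 1 = 1"
  defines "g \<equiv> cauchy_series \<phi> a" and "h \<equiv> fps_X * (1 + psi_series \<phi> b)"
  shows "F_series \<phi> a b = fps_const g * fps_in_w (1 + psi_series \<phi> b) +
    fps2_compose (K2_series \<phi> a b) g h * F_series \<phi> a b"
proof -
  let ?k = "kappa2 \<phi> a b"
  have g: "g = fps_X * left_moments ?k"
    by (rule fps_ext)
      (simp add: g_def cauchy_series_def flip: joint_moment_eq_face_sum[of \<phi> a _ b 0, OF assms(1), simplified])
  have Mb: "right_moments ?k = 1 + psi_series \<phi> b"
    by (rule fps_ext)
      (simp add: psi_series_def assms flip: joint_moment_eq_face_sum[of \<phi> a 0 b, OF assms(1), simplified])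
  have F: "F_series \<phi> a b = fps_const fps_X * joint_moments ?k"
    by (intro fps_ext) (simp add: F_series_def fps2_def flip: joint_moment_eq_face_sum[of \<phi>, OF assms(1)])
  have "fps_const fps_X * joint_moments ?k =
      fps_const fps_X * (fps_const (left_moments ?k) * fps_in_w (right_moments ?k)) +
      fps2_compose (K2_series \<phi> a b) (fps_X * left_moments ?k) (fps_X * right_moments ?k) *
        (fps_const fps_X * joint_moments ?k)"
    by (subst joint_moments_functional_equation) (simp add: K2_series_def algebra_simps)
  thus ?thesis
    unfolding F[symmetric] Mb by (simp add: h_def g mult.assoc[symmetric])
qed

text \<open>Here \<open>y\<close> makes the first argument of \<open>K\<^sub>a\<^sub>,\<^sub>b\<close> equal to \<open>z\<close>, and \<open>x\<close> makes the second one a right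
  inverse of \<open>c\<^sub>b\<close>, hence equal to its compositional inverse.\<close>

lemma F_subst_functional_equation:
  fixes \<phi> :: "'a::ring_1 \<Rightarrow> complex" and a b :: 'a
  assumes "\<phi> 1 = 1" "\<phi> b = 1"
  defines "y \<equiv> fps_inv (cauchy_series \<phi> a)" and "x \<equiv> X_series \<phi> b"
  shows "fps2_compose (F_series \<phi> a b) y x *
    (1 - fps2_compose (K2_series \<phi> a b) fps_X (fps_inv (c_series \<phi> b))) = fps_const fps_X * (1 + fps_X)"
proof -
  define g h where "g = cauchy_series \<phi> a" and "h = fps_X * (1 + psi_series \<phi> b)"
  define F K where "F = F_series \<phi> a b" and "K = K2_series \<phi> a b"
  have y0: "y $ 0 = 0" and x0: "x $ 0 = 0"
    by (simp_all add: y_def x_def X_series_def fps_inv_def)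
  have g0: "g $ 0 = 0" and h0: "h $ 0 = 0" by (simp_all add: g_def cauchy_series_def h_def)
  have gy: "g oo y = fps_X"
    using assms(1) by (simp add: g_def y_def fps_inv_right cauchy_series_def)
  have psi_x: "psi_series \<phi> b oo x = fps_X"
    using assms(2) by (simp add: x_def X_series_def fps_inv_right psi_series_def)
  have hx: "h oo x = fps_inv (c_series \<phi> b)"
  proof -
    let ?c = "c_series \<phi> b"
    have c0: "?c $ 0 = 0" by (simp add: c_series_def)
    have "free_cumulant \<phi> b 1 = 1"
    proof -
      have "face_sum (\<lambda>p q. free_cumulant \<phi> b p) 0 0 1 0 = free_cumulant \<phi> b 1"
        using face_sum_step[of 1 0 0 "\<lambda>p q. free_cumulant \<phi> b p" 0]
        by (simp add: face_sum_Suc_left[of _ 0, simplified] face_sum_0)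
      thus ?thesis using moment_eq_face_sum[of \<phi> b 1, OF assms(1)] assms(2) by simp
    qed
    hence c1: "?c $ 1 \<noteq> 0" by (simp add: c_series_def)
    have "?c oo (h oo x) = (?c oo h) oo x" by (rule fps_compose_assoc[OF x0 h0])
    hence "?c oo (h oo x) = fps_X"
      using c_series_compose_right[of \<phi> b, OF assms(1)] by (simp add: h_def psi_x)
    moreover have "fps_inv ?c oo (?c oo (h oo x)) = (fps_inv ?c oo ?c) oo (h oo x)"
      using h0 c0 by (intro fps_compose_assoc) auto
    ultimately show ?thesis using h0 by (simp add: fps_inv[OF c0 c1])
  qed
  have "fps2_compose F y x = fps2_compose (fps_const g * fps_in_w (1 + psi_series \<phi> b) +
      fps2_compose K g h * F) y x"
    using F_series_functional_equation[of \<phi> a b, OF assms(1)] by (simp add: F_def K_def g_def h_def)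
  also have "\<dots> = fps_const fps_X * (1 + fps_X) +
      fps2_compose K fps_X (fps_inv (c_series \<phi> b)) * fps2_compose F y x"
    by (simp add: fps2_compose_add fps2_compose_mult[OF y0 x0] fps2_compose_const fps2_compose_fps_in_w
        fps2_compose_fps2_compose[OF g0 h0 y0 x0] gy hx fps_compose_add_distrib psi_x
        fps_in_w_add fps_in_w_1 fps_in_w_X fps2_compose_1)
  finally show ?thesis by (simp add: F_def K_def algebra_simps)
qed

theorem proposition3p2:
  fixes scale :: "complex \<Rightarrow> 'a::ring_1 \<Rightarrow> 'a" and \<phi> :: "'a \<Rightarrow> complex" and a b :: 'a
  assumes "noncomm_prob_space scale \<phi>"
    and "\<phi> b = 1"
  shows "T_transform \<phi> a b =
    1 + 1 / var_w * fps2_to_fls2 (fps2_compose (K2_series \<phi> a b) fps_X (fps_inv (c_series \<phi> b)))"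
proof -
  have phi1: "\<phi> 1 = 1" using assms(1) by (rule noncomm_prob_space.phi_one)
  define F where "F = F_subst \<phi> a b (K_series \<phi> a) (X_series \<phi> b)"
  define K where "K = fps2_compose (K2_series \<phi> a b) fps_X (fps_inv (c_series \<phi> b))"
  define K' where "K' = fps2_to_fls2 K"
  have F: "F = fps2_to_fls2 (fps2_compose (F_series \<phi> a b) (fps_inv (cauchy_series \<phi> a)) (X_series \<phi> b))"
    by (simp add: F_def F_subst_def K_series_def)
  have one_minus: "fps2_to_fls2 (1 - K) = 1 - K'"
  proof -
    have "fps2_to_fls2 (1 - K) + K' = fps2_to_fls2 (1 - K + K)"
      unfolding K'_def by (rule fps2_to_fls2_add[symmetric])
    thus ?thesis by (simp add: fps2_to_fls2_1 eq_diff_eq)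
  qed
  have "F * (1 - K') = fps2_to_fls2 (fps_const fps_X * (1 + fps_X))"
    unfolding F one_minus[symmetric] fps2_to_fls2_mult[symmetric] K_def
    using F_subst_functional_equation[of \<phi> b a, OF phi1 assms(2)] by simp
  hence FK: "F * (1 - K') = var_z * (1 + var_w)"
    by (simp add: fps2_to_fls2_mult fps2_to_fls2_add fps2_to_fls2_const fps2_to_fls2_1 fps2_to_fls2_X)
  have w: "var_w \<noteq> 0" by simp
  have "fls_nth (1 + var_w) 0 = 1" by simp
  hence "1 + var_w \<noteq> 0" by force
  moreover have "var_z \<noteq> 0" by simp
  ultimately have "F \<noteq> 0" using FK by auto
  hence "var_z / F * (1 + var_w) = 1 - K'" using FK by (simp add: field_simps)
  hence "(var_w + 1) * (1 - var_z / F) = var_w + K'" by (simp add: algebra_simps)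
  hence "(var_w + 1) / var_w * (1 - var_z / F) = (var_w + K') / var_w"
    by (simp only: times_divide_eq_left)
  also have "\<dots> = 1 + 1 / var_w * K'"
    by (simp only: add_divide_distrib divide_self[OF w] times_divide_eq_left mult_1)
  finally have "(var_w + 1) / var_w * (1 - var_z / F) = 1 + 1 / var_w * K'" .
  thus ?thesis by (simp add: T_transform_def F_def K'_def K_def)
qed

end
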